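(* Let $(\Omega,\mathcal{F},P)$ be a probability space, let $\mathcal{G}\subset\mathcal{F}$ be a $\sigma$-algebra, and let $\boldsymbol{Y}$ be a non-negative $\mathbb{R}^n$-valued random variable with square integrable logarithm (so that $\boldsymbol{Y}$ is a.e. strictly positive). Then the unique (up to a set of $P$-measure $0$) positive $\mathcal{G}$-measurable $\boldsymbol{X}^*$ that makes $d_\ell(\boldsymbol{Y},\boldsymbol{X})^2$ minimum over $$\{\boldsymbol{X} : \boldsymbol{X}\text{ is }\mathcal{G}\text{-measurable},\ \boldsymbol{X}>0,\ E[(\ln\boldsymbol{X})^2]<\infty\}$$ is given by $\boldsymbol{X}^*=\exp\left(E[\ln\boldsymbol{Y}\,|\,\mathcal{G}]\right)$.
   Context: All operations, inequalities and integrability conditions on vectors are componentwise; in particular $E[(\ln \boldsymbol{X})^2]<\infty$ means $E[(\ln X_i)^2]<\infty$ for $i=1,\dots,n$. For strictly positive $(0,\infty)^n$-valued random variables with square integrable logarithms, the logarithmic distance is defined by $$d_\ell(\boldsymbol{X}_1,\boldsymbol{X}_2)^2=E\left[\sum_{i=1}^n\left(\ln X_1(i)-\ln X_2(i)\right)^2\right].$$ *)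

theory Defs
  imports "HOL-Probability.Probability"
begin

definition ln_vec :: "real ^ 'n \<Rightarrow> real ^ 'n" where
  "ln_vec v = (\<chi> i. ln (v $ i))"

definition exp_vec :: "real ^ 'n \<Rightarrow> real ^ 'n" where
  "exp_vec v = (\<chi> i. exp (v $ i))"

definition cond_exp_vec ::
  "'a measure \<Rightarrow> 'a measure \<Rightarrow> ('a \<Rightarrow> real ^ 'n) \<Rightarrow> 'a \<Rightarrow> real ^ 'n" where
  "cond_exp_vec M G f = (\<lambda>\<omega>. \<chi> i. real_cond_exp M G (\<lambda>\<omega>'. f \<omega>' $ i) \<omega>)"

(* The library's ln is total, with ln 0 = 0.  For square integrability of the logarithm of a
   non-negative variable, ln 0 has to be -infinity, so its square is infinity at 0.  The value
   at negative arguments is never used. *)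
definition ln_sq :: "real \<Rightarrow> ennreal" where
  "ln_sq x = (if 0 < x then ennreal ((ln x)\<^sup>2) else \<infinity>)"

definition square_integrable_ln :: "'a measure \<Rightarrow> ('a \<Rightarrow> real ^ 'n) \<Rightarrow> bool" where
  "square_integrable_ln M X \<longleftrightarrow> (\<forall>i. (\<integral>\<^sup>+ \<omega>. ln_sq (X \<omega> $ i) \<partial>M) < \<infinity>)"

(* Meant for (a.e.) strictly positive arguments with square integrable logarithms; the integrand
   is then integrable, and the value of ln at 0 only matters on a null set. *)
definition log_dist :: "'a measure \<Rightarrow> ('a \<Rightarrow> real ^ 'n) \<Rightarrow> ('a \<Rightarrow> real ^ 'n) \<Rightarrow> real" where
  "log_dist M X1 X2 =
     sqrt (\<integral>\<omega>. (\<Sum>i\<in>UNIV. (ln (X1 \<omega> $ i) - ln (X2 \<omega> $ i))\<^sup>2) \<partial>M)"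

definition log_candidates :: "'a measure \<Rightarrow> 'a measure \<Rightarrow> ('a \<Rightarrow> real ^ 'n) set" where
  "log_candidates M G =
     {X. X \<in> borel_measurable G \<and> (\<forall>\<omega>\<in>space M. \<forall>i. 0 < X \<omega> $ i) \<and> square_integrable_ln M X}"

lemma borel_measurable_ln_sq [measurable]: "ln_sq \<in> borel_measurable borel"
  unfolding ln_sq_def[abs_def] by measurable

lemma borel_measurable_vec_component:
  fixes X :: "'a \<Rightarrow> real ^ 'n"
  assumes "X \<in> borel_measurable M"
  shows "(\<lambda>\<omega>. X \<omega> $ i) \<in> borel_measurable M"
  by (rule borel_measurable_continuous_on[OF _ assms]) (intro continuous_intros)

lemma square_integrable_ln_imp_AE_pos:
  fixes X :: "'a \<Rightarrow> real ^ 'n"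
  assumes X: "X \<in> borel_measurable M" and sq: "square_integrable_ln M X"
  shows "AE \<omega> in M. \<forall>i. 0 < X \<omega> $ i"
proof -
  have "AE \<omega> in M. 0 < X \<omega> $ i" for i
  proof -
    have m: "(\<lambda>\<omega>. ln_sq (X \<omega> $ i)) \<in> borel_measurable M"
      using borel_measurable_vec_component[OF X] by measurable
    have "(\<integral>\<^sup>+ \<omega>. ln_sq (X \<omega> $ i) \<partial>M) \<noteq> \<infinity>"
      using sq unfolding square_integrable_ln_def by (metis less_irrefl)
    from nn_integral_PInf_AE[OF m this] show ?thesis
      by eventually_elim (simp add: ln_sq_def split: if_splits)
  qed
  then show ?thesis
    by (simp add: AE_all_countable)
qed

lemma square_integrable_ln_iff_integrable:
  fixes X :: "'a \<Rightarrow> real ^ 'n"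
  assumes X: "X \<in> borel_measurable M" and pos: "AE \<omega> in M. \<forall>i. 0 < X \<omega> $ i"
  shows "square_integrable_ln M X \<longleftrightarrow> (\<forall>i. integrable M (\<lambda>\<omega>. (ln (X \<omega> $ i))\<^sup>2))"
proof -
  have "(\<integral>\<^sup>+ \<omega>. ln_sq (X \<omega> $ i) \<partial>M) < \<infinity> \<longleftrightarrow> integrable M (\<lambda>\<omega>. (ln (X \<omega> $ i))\<^sup>2)" for i
  proof -
    have eq: "(\<integral>\<^sup>+ \<omega>. ln_sq (X \<omega> $ i) \<partial>M) = (\<integral>\<^sup>+ \<omega>. ennreal (norm ((ln (X \<omega> $ i))\<^sup>2)) \<partial>M)"
      using pos by (intro nn_integral_cong_AE) (auto simp: ln_sq_def elim: eventually_mono)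
    have "(\<lambda>\<omega>. (ln (X \<omega> $ i))\<^sup>2) \<in> borel_measurable M"
      using borel_measurable_vec_component[OF X] by measurable
    then show ?thesis
      unfolding eq integrable_iff_bounded by simp
  qed
  then show ?thesis
    by (simp add: square_integrable_ln_def)
qed

end

theory Submission
  imports Defs
begin

text \<open>
  Taking logarithms turns the logarithmic distance into the Hilbert space distance of
  \<open>L\<^sup>2\<close>, applied coordinate by coordinate, and turns the candidates into arbitrary square
  integrable variables that are measurable with respect to \<open>G\<close>. The theorem is therefore the
  statement that conditional expectation is the orthogonal projection onto the closed subspace of
  such variables, transported back by the exponential.

  Given a subalgebra \<open>F\<close>, the error \<open>f - E[f|F]\<close> is orthogonal to every
  square integrable \<open>F\<close>-measurable variable
  (\<open>cond_exp_error_orthogonal\<close>), which gives the Pythagorean identity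
  \<open>cond_exp_pythagoras\<close> for a single coordinate. Summing over the coordinates yields
  \<open>log_dist_pythagoras\<close>: the squared distance from \<open>Y\<close> to a candidate
  \<open>X\<close> is the squared distance from \<open>Y\<close> to \<open>exp (E[ln Y|G])\<close>
  plus the squared distance from \<open>exp (E[ln Y|G])\<close> to \<open>X\<close>. The second
  term is non-negative, which gives minimality, and it vanishes only when the two variables agree
  almost everywhere (\<open>log_dist_eq_0_imp_AE_eq\<close>), which gives uniqueness.
\<close>

section \<open>Conditional expectation as an orthogonal projection\<close>

lemma integrable_mult_of_squares:
  fixes f g :: "'a \<Rightarrow> real"
  assumes [measurable]: "f \<in> borel_measurable M" "g \<in> borel_measurable M"
    and "integrable M (\<lambda>x. (f x)\<^sup>2)" "integrable M (\<lambda>x. (g x)\<^sup>2)"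
  shows "integrable M (\<lambda>x. f x * g x)"
proof (rule Bochner_Integration.integrable_bound)
  show "integrable M (\<lambda>x. (f x)\<^sup>2 + (g x)\<^sup>2)"
    using assms by simp
  have "\<bar>a * b\<bar> \<le> a\<^sup>2 + b\<^sup>2" for a b :: real
    using sum_squares_bound[of "\<bar>a\<bar>" "\<bar>b\<bar>"] abs_ge_zero[of "a * b"]
    unfolding abs_mult power2_abs by linarith
  then show "AE x in M. norm (f x * g x) \<le> norm ((f x)\<^sup>2 + (g x)\<^sup>2)"
    by simp
qed measurable

lemma integrable_square_diff:
  fixes f g :: "'a \<Rightarrow> real"
  assumes "f \<in> borel_measurable M" "g \<in> borel_measurable M"
    and "integrable M (\<lambda>x. (f x)\<^sup>2)" "integrable M (\<lambda>x. (g x)\<^sup>2)"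
  shows "integrable M (\<lambda>x. (f x - g x)\<^sup>2)"
  using integrable_mult_of_squares[OF assms] assms(3,4)
  by (simp add: power2_diff mult.assoc)

context finite_measure_subalgebra
begin

text \<open>Conditional Jensen, applied to the convex function \<open>x \<mapsto> x\<^sup>2\<close>, bounds \<open>E[f|F]\<^sup>2\<close> by the
  integrable variable \<open>E[f\<^sup>2|F]\<close>. This keeps the projection inside \<open>L\<^sup>2\<close>.\<close>

lemma integrable_square_cond_exp:
  assumes f: "f \<in> borel_measurable M" "integrable M (\<lambda>x. (f x)\<^sup>2)"
  shows "integrable M (\<lambda>x. (real_cond_exp M F f x)\<^sup>2)"
proof (rule integrable_convex_cond_exp[where I = UNIV and q = "\<lambda>x. x\<^sup>2"])
  show "integrable M f"
    by (rule square_integrable_imp_integrable[OF f])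
  show "convex_on UNIV (\<lambda>x::real. x\<^sup>2)"
    by (rule convex_power2)
qed (use f(2) in simp_all)

text \<open>The defining property \<open>E[k E[f|F]] = E[k f]\<close> of conditional expectation says exactly that the
  error \<open>f - E[f|F]\<close> is orthogonal to \<open>k\<close>. Square integrability of both factors makes \<open>k f\<close>
  integrable, so the property applies.\<close>

lemma cond_exp_error_orthogonal:
  assumes f: "f \<in> borel_measurable M" "integrable M (\<lambda>x. (f x)\<^sup>2)"
    and k: "k \<in> borel_measurable F" "integrable M (\<lambda>x. (k x)\<^sup>2)"
  shows "(\<integral>x. k x * (f x - real_cond_exp M F f x) \<partial>M) = 0"
proof -
  have kf: "integrable M (\<lambda>x. k x * f x)"
    using integrable_mult_of_squares[OF measurable_from_subalg[OF subalg k(1)] f(1) k(2) f(2)] .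
  show ?thesis
    using kf real_cond_exp_intg[OF kf k(1) f(1)] by (simp add: right_diff_distrib)
qed

text \<open>The difference \<open>E[f|F] - h\<close> is itself \<open>F\<close>-measurable and square integrable, so the cross term
  in the square of \<open>f - h = (f - E[f|F]) + (E[f|F] - h)\<close> integrates to zero.\<close>

lemma cond_exp_pythagoras:
  assumes f: "f \<in> borel_measurable M" "integrable M (\<lambda>x. (f x)\<^sup>2)"
    and h: "h \<in> borel_measurable F" "integrable M (\<lambda>x. (h x)\<^sup>2)"
  shows "(\<integral>x. (f x - h x)\<^sup>2 \<partial>M)
    = (\<integral>x. (f x - real_cond_exp M F f x)\<^sup>2 \<partial>M) + (\<integral>x. (real_cond_exp M F f x - h x)\<^sup>2 \<partial>M)"
proof -
  let ?e = "real_cond_exp M F f"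
  let ?k = "\<lambda>x. ?e x - h x"
  have hM: "h \<in> borel_measurable M"
    by (rule measurable_from_subalg[OF subalg h(1)])
  have e: "?e \<in> borel_measurable M" "integrable M (\<lambda>x. (?e x)\<^sup>2)"
    using integrable_square_cond_exp[OF f] by simp_all
  have fe: "integrable M (\<lambda>x. (f x - ?e x)\<^sup>2)"
    by (rule integrable_square_diff[OF f(1) e(1) f(2) e(2)])
  have k: "?k \<in> borel_measurable F" "?k \<in> borel_measurable M" "integrable M (\<lambda>x. (?k x)\<^sup>2)"
    using h(1) hM integrable_square_diff[OF e(1) hM e(2) h(2)] by simp_all
  have cross: "integrable M (\<lambda>x. ?k x * (f x - ?e x))"
    by (rule integrable_mult_of_squares[OF k(2) _ k(3) fe]) (use f(1) e(1) in simp)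
  have expand: "(f x - h x)\<^sup>2 = (f x - ?e x)\<^sup>2 + (?k x)\<^sup>2 + 2 * (?k x * (f x - ?e x))" for x
    by (simp add: power2_eq_square algebra_simps)
  have "(\<integral>x. (f x - h x)\<^sup>2 \<partial>M)
    = (\<integral>x. (f x - ?e x)\<^sup>2 \<partial>M) + (\<integral>x. (?k x)\<^sup>2 \<partial>M) + 2 * (\<integral>x. ?k x * (f x - ?e x) \<partial>M)"
    unfolding expand using fe k(3) cross by simp
  then show ?thesis
    using cond_exp_error_orthogonal[OF f k(1,3)] by simp
qed

end

section \<open>Strictly positive vectors with square integrable logarithm\<close>

lemma measurable_ln_component:
  fixes X :: "'a \<Rightarrow> real ^ 'n"
  assumes "X \<in> borel_measurable M"
  shows "(\<lambda>\<omega>. ln (X \<omega> $ i)) \<in> borel_measurable M"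
  using borel_measurable_vec_component[OF assms] by measurable

lemma borel_measurable_vec_lambda:
  fixes f :: "'n::finite \<Rightarrow> 'a \<Rightarrow> real"
  assumes "\<And>i. f i \<in> borel_measurable M"
  shows "(\<lambda>\<omega>. \<chi> i. f i \<omega>) \<in> borel_measurable M"
  by (subst borel_measurable_euclidean_space)
     (use assms in \<open>auto simp: Basis_vec_def inner_axis\<close>)

lemma square_integrable_ln_component:
  fixes X :: "'a \<Rightarrow> real ^ 'n"
  assumes "X \<in> borel_measurable M" "square_integrable_ln M X"
  shows "integrable M (\<lambda>\<omega>. (ln (X \<omega> $ i))\<^sup>2)"
  using square_integrable_ln_iff_integrable[OF assms(1) square_integrable_ln_imp_AE_pos[OF assms]]
    assms(2) by blast

lemma log_candidates_measurable:
  assumes "subalgebra M G" "X \<in> log_candidates M G"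
  shows "X \<in> borel_measurable M"
  using assms by (auto simp: log_candidates_def intro: measurable_from_subalg)

lemma log_dist_power2:
  fixes X1 X2 :: "'a \<Rightarrow> real ^ 'n"
  assumes "X1 \<in> borel_measurable M" "square_integrable_ln M X1"
    and "X2 \<in> borel_measurable M" "square_integrable_ln M X2"
  shows "(log_dist M X1 X2)\<^sup>2 = (\<Sum>i\<in>UNIV. \<integral>\<omega>. (ln (X1 \<omega> $ i) - ln (X2 \<omega> $ i))\<^sup>2 \<partial>M)"
proof -
  have "integrable M (\<lambda>\<omega>. (ln (X1 \<omega> $ i) - ln (X2 \<omega> $ i))\<^sup>2)" for i
    using assms by (intro integrable_square_diff measurable_ln_component
        square_integrable_ln_component)
  then show ?thesis
    by (simp add: log_dist_def integral_nonneg_AE sum_nonneg)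
qed

text \<open>A sum of non-negative integrals vanishes only if every integrand vanishes almost everywhere, so
  the logarithms agree in each coordinate. The logarithm is injective on the positive reals, and
  square integrability of \<open>ln X1\<close> and \<open>ln X2\<close> forces both variables to be positive almost
  everywhere.\<close>

lemma log_dist_eq_0_imp_AE_eq:
  fixes X1 X2 :: "'a \<Rightarrow> real ^ 'n"
  assumes X1: "X1 \<in> borel_measurable M" "square_integrable_ln M X1"
    and X2: "X2 \<in> borel_measurable M" "square_integrable_ln M X2"
    and zero: "log_dist M X1 X2 = 0"
  shows "AE \<omega> in M. X1 \<omega> = X2 \<omega>"
proof -
  have "AE \<omega> in M. (ln (X1 \<omega> $ i) - ln (X2 \<omega> $ i))\<^sup>2 = 0" for i
  proof -
    have int: "integrable M (\<lambda>\<omega>. (ln (X1 \<omega> $ i) - ln (X2 \<omega> $ i))\<^sup>2)"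
      using X1 X2 by (intro integrable_square_diff measurable_ln_component
          square_integrable_ln_component)
    have "(\<Sum>i\<in>UNIV. \<integral>\<omega>. (ln (X1 \<omega> $ i) - ln (X2 \<omega> $ i))\<^sup>2 \<partial>M) = 0"
      using log_dist_power2[OF X1 X2] zero by simp
    then have "(\<integral>\<omega>. (ln (X1 \<omega> $ i) - ln (X2 \<omega> $ i))\<^sup>2 \<partial>M) = 0"
      by (subst (asm) sum_nonneg_eq_0_iff) auto
    then show ?thesis
      using integral_nonneg_eq_0_iff_AE[OF int] by simp
  qed
  then have "AE \<omega> in M. \<forall>i. (ln (X1 \<omega> $ i) - ln (X2 \<omega> $ i))\<^sup>2 = 0"
    by (simp add: AE_all_countable)
  then show ?thesis
    using square_integrable_ln_imp_AE_pos[OF X1] square_integrable_ln_imp_AE_pos[OF X2]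
    by eventually_elim (simp add: vec_eq_iff)
qed

section \<open>The geometric conditional expectation\<close>

text \<open>For the trivial algebra this is the componentwise geometric mean \<open>exp (E[ln Y])\<close>, hence the
  name.\<close>

definition geometric_cond_exp ::
  "'a measure \<Rightarrow> 'a measure \<Rightarrow> ('a \<Rightarrow> real ^ 'n) \<Rightarrow> 'a \<Rightarrow> real ^ 'n" where
  "geometric_cond_exp M G Y = (\<lambda>\<omega>. exp_vec (cond_exp_vec M G (\<lambda>\<omega>'. ln_vec (Y \<omega>')) \<omega>))"

lemma geometric_cond_exp_component:
  "geometric_cond_exp M G Y \<omega> $ i = exp (real_cond_exp M G (\<lambda>\<omega>'. ln (Y \<omega>' $ i)) \<omega>)"
  by (simp add: geometric_cond_exp_def exp_vec_def cond_exp_vec_def ln_vec_def)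

context finite_measure_subalgebra
begin

lemma geometric_cond_exp_candidate:
  fixes Y :: "'a \<Rightarrow> real ^ 'n"
  assumes Y: "Y \<in> borel_measurable M" "square_integrable_ln M Y"
  shows "geometric_cond_exp M F Y \<in> log_candidates M F"
proof -
  have "(\<lambda>\<omega>. \<chi> i. exp (real_cond_exp M F (\<lambda>\<omega>'. ln (Y \<omega>' $ i)) \<omega>)) \<in> borel_measurable F"
    by (intro borel_measurable_vec_lambda) measurable
  moreover have "geometric_cond_exp M F Y
      = (\<lambda>\<omega>. \<chi> i. exp (real_cond_exp M F (\<lambda>\<omega>'. ln (Y \<omega>' $ i)) \<omega>))"
    by (simp add: fun_eq_iff vec_eq_iff geometric_cond_exp_component)
  ultimately have meas: "geometric_cond_exp M F Y \<in> borel_measurable F"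
    by simp
  have pos: "0 < geometric_cond_exp M F Y \<omega> $ i" for \<omega> i
    by (simp add: geometric_cond_exp_component)
  have "integrable M (\<lambda>\<omega>. (ln (geometric_cond_exp M F Y \<omega> $ i))\<^sup>2)" for i
    using integrable_square_cond_exp[OF measurable_ln_component[OF Y(1)]
        square_integrable_ln_component[OF Y]]
    by (simp add: geometric_cond_exp_component)
  then have "square_integrable_ln M (geometric_cond_exp M F Y)"
    using square_integrable_ln_iff_integrable[OF measurable_from_subalg[OF subalg meas]] pos
    by simp
  then show ?thesis
    using meas pos by (simp add: log_candidates_def)
qed

text \<open>Both \<open>X\<close> and the geometric conditional expectation are candidates, so in each coordinate their
  logarithms lie in the subspace onto which the conditional expectation of \<open>ln Y\<close> projects.\<close>

lemma log_dist_pythagoras: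
  fixes X Y :: "'a \<Rightarrow> real ^ 'n"
  assumes Y: "Y \<in> borel_measurable M" "square_integrable_ln M Y"
    and X: "X \<in> log_candidates M F"
  shows "(log_dist M Y X)\<^sup>2
    = (log_dist M Y (geometric_cond_exp M F Y))\<^sup>2 + (log_dist M (geometric_cond_exp M F Y) X)\<^sup>2"
proof -
  let ?Z = "geometric_cond_exp M F Y"
  have XF: "X \<in> borel_measurable F" and X': "X \<in> borel_measurable M" "square_integrable_ln M X"
    using X log_candidates_measurable[OF subalg X] by (simp_all add: log_candidates_def)
  have Z: "?Z \<in> borel_measurable M" "square_integrable_ln M ?Z"
    using geometric_cond_exp_candidate[OF Y] log_candidates_measurable[OF subalg]
    by (auto simp: log_candidates_def)
  have "(\<integral>\<omega>. (ln (Y \<omega> $ i) - ln (X \<omega> $ i))\<^sup>2 \<partial>M)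
    = (\<integral>\<omega>. (ln (Y \<omega> $ i) - ln (?Z \<omega> $ i))\<^sup>2 \<partial>M) + (\<integral>\<omega>. (ln (?Z \<omega> $ i) - ln (X \<omega> $ i))\<^sup>2 \<partial>M)" for i
    using cond_exp_pythagoras[OF measurable_ln_component[OF Y(1)]
        square_integrable_ln_component[OF Y] measurable_ln_component[OF XF]
        square_integrable_ln_component[OF X']]
    by (simp add: geometric_cond_exp_component)
  then show ?thesis
    by (simp add: log_dist_power2[OF Y X'] log_dist_power2[OF Y Z] log_dist_power2[OF Z X']
        sum.distrib)
qed

end

theorem theorem3p1:
  fixes M G :: "'a measure" and Y :: "'a \<Rightarrow> real ^ 'n"
  assumes "prob_space M"
    and "subalgebra M G"
    and "Y \<in> borel_measurable M"
    and "\<forall>\<omega>\<in>space M. \<forall>i. 0 \<le> Y \<omega> $ i"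
    and "square_integrable_ln M Y"
  shows
    "let Xstar = (\<lambda>\<omega>. exp_vec (cond_exp_vec M G (\<lambda>\<omega>'. ln_vec (Y \<omega>')) \<omega>));
         minimizes = is_arg_min (\<lambda>X. (log_dist M Y X)\<^sup>2) (\<lambda>X. X \<in> log_candidates M G)
     in minimizes Xstar \<and> (\<forall>X. minimizes X \<longrightarrow> (AE \<omega> in M. X \<omega> = Xstar \<omega>))"
proof -
  interpret prob_space M by (rule assms(1))
  interpret finite_measure_subalgebra M G by unfold_locales (rule assms(2))
  let ?Z = "geometric_cond_exp M G Y"
  let ?min = "is_arg_min (\<lambda>X. (log_dist M Y X)\<^sup>2) (\<lambda>X. X \<in> log_candidates M G)"
  note pythagoras = log_dist_pythagoras[OF assms(3,5)]
  have Z: "?Z \<in> log_candidates M G"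
    by (rule geometric_cond_exp_candidate[OF assms(3,5)])
  have "(log_dist M Y ?Z)\<^sup>2 \<le> (log_dist M Y X)\<^sup>2"
    if "X \<in> log_candidates M G" for X
    unfolding pythagoras[OF that] by simp
  then have "?min ?Z"
    using Z by (simp add: is_arg_min_linorder)
  moreover have "AE \<omega> in M. X \<omega> = ?Z \<omega>" if "?min X" for X
  proof -
    have X: "X \<in> log_candidates M G" and le: "(log_dist M Y X)\<^sup>2 \<le> (log_dist M Y ?Z)\<^sup>2"
      using that Z by (simp_all add: is_arg_min_linorder)
    have "log_dist M ?Z X = 0"
      using le pythagoras[OF X] by simp
    then have "AE \<omega> in M. ?Z \<omega> = X \<omega>"
      using X Z log_candidates_measurable[OF assms(2)]
      by (intro log_dist_eq_0_imp_AE_eq) (auto simp: log_candidates_def)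
    then show ?thesis
      by eventually_elim simp
  qed
  ultimately show ?thesis
    by (simp add: geometric_cond_exp_def)
qed

end
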